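(* Let $n\ge1$ and $\rho\ge 0$ be integers, and let $\mathcal{S}_i\in\mathbb{R}^{n\times q_i}$, $i=0,\dots,\rho$, be matrices of full column rank with $q_i\geq 1$ and $\sum_{i=0}^{\rho}q_i=n$. Let $Q,G_0\in\mathbb{R}^{n\times n}$ be symmetric and let $\mathcal{W}_0,\dots,\mathcal{W}_\rho\in\mathbb{R}^{n\times n}$ be symmetric positive definite. Define, for $k=0,\dots,\rho$, $$G_{k+1}=Q+(I-\mathcal{W}_k\Pi_k)(G_k-Q)(I-\Pi_k\mathcal{W}_k),\qquad \Pi_k:=\mathcal{S}_k(\mathcal{S}_k^T\mathcal{W}_k\mathcal{S}_k)^{-1}\mathcal{S}_k^T .$$ If $\mathcal{S}_k^T\mathcal{W}_k\mathcal{S}_i=0$ for all $0\le i<k\le\rho$, then $$G_{k+1}\mathcal{S}_i=Q\mathcal{S}_i\qquad\text{for all } 0\le i\le k\le\rho,$$ and $G_{\rho+1}=Q$.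
   Context: $I$ denotes the $n\times n$ identity matrix. The property $G_{k+1}\mathcal{S}_i=Q\mathcal{S}_i$ for $i\le k$ is called the quadratic hereditary property. *)

theory Defs
  imports "Jordan_Normal_Form.DL_Rank" "Jordan_Normal_Form.Gauss_Jordan_Elimination"
begin

definition sym_mat :: "'a mat \<Rightarrow> bool" where
  "sym_mat A \<longleftrightarrow> A\<^sup>T = A"

definition sym_pos_def_mat :: "real mat \<Rightarrow> bool" where
  "sym_pos_def_mat A \<longleftrightarrow> sym_mat A \<and>
     (\<forall>v \<in> carrier_vec (dim_col A). v \<noteq> 0\<^sub>v (dim_col A) \<longrightarrow> v \<bullet> (A *\<^sub>v v) > 0)"

text \<open>\<^const>\<open>mat_inverse\<close> returns an option; \<open>the\<close> is harmless below, because the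
  inverted matrix is always invertible when \<open>W\<close> is positive definite and \<open>S\<close> has full column
  rank.\<close>

definition proj_mat :: "real mat \<Rightarrow> real mat \<Rightarrow> real mat" where
  "proj_mat S W = S * the (mat_inverse (S\<^sup>T * W * S)) * S\<^sup>T"

primrec G_seq :: "nat \<Rightarrow> real mat \<Rightarrow> real mat \<Rightarrow> (nat \<Rightarrow> real mat) \<Rightarrow> (nat \<Rightarrow> real mat)
    \<Rightarrow> nat \<Rightarrow> real mat" where
  "G_seq n Q G0 S W 0 = G0"
| "G_seq n Q G0 S W (Suc k) =
     Q + (1\<^sub>m n - W k * proj_mat (S k) (W k)) * (G_seq n Q G0 S W k - Q)
           * (1\<^sub>m n - proj_mat (S k) (W k) * W k)"

end

theory Submission
  imports Defs
begin

text \<open>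
  Put \<open>E\<^sub>k = G\<^sub>k - Q\<close> and \<open>B\<^sub>k = I - \<Pi>\<^sub>k W\<^sub>k\<close>, so that \<open>E\<^sub>k\<^sub>+\<^sub>1 = (I - W\<^sub>k \<Pi>\<^sub>k) E\<^sub>k B\<^sub>k\<close>.
  The matrix \<open>\<Pi>\<^sub>k W\<^sub>k\<close> is the projector onto the range of \<open>S\<^sub>k\<close> that is orthogonal for the inner
  product of \<open>W\<^sub>k\<close>. Hence \<open>B\<^sub>k\<close> kills \<open>S\<^sub>k\<close> (\<open>proj_mat_complement_annihilates\<close>) and fixes every
  \<open>S\<^sub>i\<close> that is \<open>W\<^sub>k\<close>-conjugate to \<open>S\<^sub>k\<close> (\<open>proj_mat_complement_fixes\<close>). So step \<open>k\<close> makes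
  \<open>E\<^sub>k\<^sub>+\<^sub>1 S\<^sub>k = 0\<close>, and since \<open>B\<^sub>k S\<^sub>i = S\<^sub>i\<close> for \<open>i < k\<close>, it keeps the equations \<open>E\<^sub>k S\<^sub>i = 0\<close>
  that earlier steps have produced. This is the hereditary property.

  After the last step \<open>E\<close> vanishes on all the \<open>S\<^sub>i\<close>, which have \<open>n\<close> columns in total. These
  columns are linearly independent even though the weights \<open>W\<^sub>k\<close> vary: conjugacy is a
  block-triangularity condition, and its diagonal blocks \<open>S\<^sub>k\<^sup>T W\<^sub>k S\<^sub>k\<close> are nonsingular, so in a
  vanishing combination the coefficients can be eliminated from the last block down
  (\<open>block_triangular_concatenation\<close>). The concatenation of the \<open>S\<^sub>i\<close> is thus an invertible square
  matrix, and \<open>E = 0\<close>.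
\<close>

section \<open>Trivial kernels, full rank and invertibility\<close>

text \<open>The rank is the size of a maximal independent set of columns. Full rank therefore forces
  the columns to be pairwise distinct as well as independent, and both are needed before a kernel
  vector can be read as a dependence between columns.\<close>

lemma full_column_rank_imp_trivial_kernel:
  fixes A :: "'a::field mat"
  assumes A: "A \<in> carrier_mat n nc" and rank: "vec_space.rank n A = nc"
    and v: "v \<in> carrier_vec nc" and Av: "A *\<^sub>v v = 0\<^sub>v n"
  shows "v = 0\<^sub>v nc"
proof (rule ccontr)
  assume nz: "v \<noteq> 0\<^sub>v nc"
  interpret vec_space "TYPE('a)" n .
  obtain U where U: "maximal U (\<lambda>T. T \<subseteq> set (cols A) \<and> lin_indpt T)"
    using maximal_exists[of "(\<lambda>T. T \<subseteq> set (cols A) \<and> lin_indpt T)" "card (set (cols A))" "{}"]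
    by (meson List.finite_set card_mono empty_iff empty_subsetI finite_lin_indpt2 rev_finite_subset)
  have "nc = card U" using rank_card_indpt[OF A U] rank by simp
  also have "\<dots> \<le> card (set (cols A))" using U by (simp add: card_mono maximal_def)
  finally have "distinct (cols A)"
    using A by (metis card_distinct card_length cols_length carrier_matD(2) le_antisym)
  then show False
    using full_rank_lin_indpt[OF A rank] lin_depI[OF A v nz Av] by blast
qed

lemma trivial_kernel_imp_mat_inverse:
  fixes A :: "'a::field mat"
  assumes A: "A \<in> carrier_mat n n"
    and inj: "\<And>v. v \<in> carrier_vec n \<Longrightarrow> A *\<^sub>v v = 0\<^sub>v n \<Longrightarrow> v = 0\<^sub>v n"
  obtains B where "B \<in> carrier_mat n n" "A * B = 1\<^sub>m n" "B * A = 1\<^sub>m n" "mat_inverse A = Some B"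
proof -
  have "det A \<noteq> 0" using inj det_0_iff_vec_prod_zero_field[OF A] by blast
  then have "A \<in> Units (ring_mat TYPE('a) n ())" by (rule det_non_zero_imp_unit[OF A])
  then obtain B where "mat_inverse A = Some B"
    using mat_inverse(1)[OF A, of "()"] by fastforce
  then show thesis using mat_inverse(2)[OF A] that by blast
qed

section \<open>The weighted projector onto a column space\<close>

context
  fixes n q :: nat and S W :: "real mat"
  assumes S: "S \<in> carrier_mat n q" and W: "W \<in> carrier_mat n n"
    and pd: "sym_pos_def_mat W"
    and inj: "\<And>v. v \<in> carrier_vec q \<Longrightarrow> S *\<^sub>v v = 0\<^sub>v n \<Longrightarrow> v = 0\<^sub>v q"
begin

text \<open>If \<open>S\<^sup>T W S v = 0\<close> then \<open>(S v) \<bullet> W (S v) = v \<bullet> S\<^sup>T W S v = 0\<close>, so \<open>S v = 0\<close> by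
  definiteness.\<close>

lemma weighted_gram_trivial_kernel:
  assumes v: "v \<in> carrier_vec q" and 0: "S\<^sup>T * W * S *\<^sub>v v = 0\<^sub>v q"
  shows "v = 0\<^sub>v q"
proof -
  have Sv: "S *\<^sub>v v \<in> carrier_vec n" using S v by auto
  have "S\<^sup>T * W * S *\<^sub>v v = S\<^sup>T *\<^sub>v (W *\<^sub>v (S *\<^sub>v v))"
    using S W v by (simp add: assoc_mult_mat_vec[of _ q n _ q] assoc_mult_mat_vec[of _ n n _ q])
  then have "(S\<^sup>T *\<^sub>v (W *\<^sub>v (S *\<^sub>v v))) \<bullet> v = 0"
    using scalar_prod_left_zero[OF v] 0 by metis
  then have "(S *\<^sub>v v) \<bullet> (W *\<^sub>v (S *\<^sub>v v)) = 0"
    using transpose_vec_mult_scalar[OF S v, of "W *\<^sub>v (S *\<^sub>v v)"] S W Sv v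
    by (simp add: comm_scalar_prod[of "S *\<^sub>v v" n])
  then show ?thesis
    using pd Sv W inj[OF v] unfolding sym_pos_def_mat_def by fastforce
qed

lemma weighted_gram_inverse:
  obtains B where "B \<in> carrier_mat q q" "B * (S\<^sup>T * W * S) = 1\<^sub>m q"
    "mat_inverse (S\<^sup>T * W * S) = Some B"
proof (rule trivial_kernel_imp_mat_inverse)
  show "S\<^sup>T * W * S \<in> carrier_mat q q" using S W by auto
qed (use weighted_gram_trivial_kernel that in blast)+

lemma proj_mat_carrier: "proj_mat S W \<in> carrier_mat n n"
  using weighted_gram_inverse S unfolding proj_mat_def
  by (metis mult_carrier_mat option.sel transpose_carrier_mat)

text \<open>The action of \<open>\<Pi> W\<close> on \<open>X\<close> depends on \<open>X\<close> only through \<open>S\<^sup>T W X\<close>. The two cases of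
  interest are \<open>X = S\<close>, where this is the Gram matrix itself, and \<open>X\<close> conjugate to \<open>S\<close>, where it
  is zero.\<close>

lemma proj_mat_weighted_mult:
  assumes X: "X \<in> carrier_mat n p"
  shows "proj_mat S W * W * X = S * (the (mat_inverse (S\<^sup>T * W * S)) * (S\<^sup>T * W * X))"
proof -
  obtain B where "B \<in> carrier_mat q q" "mat_inverse (S\<^sup>T * W * S) = Some B"
    using weighted_gram_inverse .
  then show ?thesis
    unfolding proj_mat_def using S W X
    by (simp add: assoc_mult_mat[of _ n q _ q _ n] assoc_mult_mat[of _ n q _ n _ n]
        assoc_mult_mat[of _ n q _ n _ p] assoc_mult_mat[of _ q q _ n _ n]
        assoc_mult_mat[of _ q q _ n _ p])
qed

lemma proj_mat_complement_annihilates: "(1\<^sub>m n - proj_mat S W * W) * S = 0\<^sub>m n q"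
proof -
  have "the (mat_inverse (S\<^sup>T * W * S)) * (S\<^sup>T * W * S) = 1\<^sub>m q"
    using weighted_gram_inverse by fastforce
  then have "proj_mat S W * W * S = S"
    using proj_mat_weighted_mult[OF S] S by simp
  then show ?thesis
    using S W proj_mat_carrier by (simp add: minus_mult_distrib_mat[of _ n n])
qed

lemma proj_mat_complement_fixes:
  assumes X: "X \<in> carrier_mat n p" and conj: "S\<^sup>T * W * X = 0\<^sub>m q p"
  shows "(1\<^sub>m n - proj_mat S W * W) * X = X"
proof -
  have "the (mat_inverse (S\<^sup>T * W * S)) \<in> carrier_mat q q"
    using weighted_gram_inverse by fastforce
  then have "proj_mat S W * W * X = 0\<^sub>m n p"
    using proj_mat_weighted_mult[OF X] conj S by simp
  then have "(1\<^sub>m n - proj_mat S W * W) * X = X - 0\<^sub>m n p"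
    using W X proj_mat_carrier by (simp add: minus_mult_distrib_mat[of _ n n])
  also have "\<dots> = X" using X by (intro eq_matI) auto
  finally show ?thesis .
qed

end

section \<open>Independence of block-triangular families\<close>

text \<open>The witness \<open>T\<close> is the concatenation \<open>[S 0, \<dots>, S (m - 1)]\<close>. It is characterised
  by what is used of it: its columns are independent, and every matrix that kills all the blocks
  kills \<open>T\<close>. The second property also drives the induction: applied to \<open>L m\<close>, it gives
  \<open>L m * T = 0\<close>, so \<open>L m\<close> isolates the coefficients of the new block in a vanishing
  combination.\<close>

lemma block_triangular_concatenation:
  fixes S L :: "nat \<Rightarrow> 'a::field mat"
  assumes "\<And>i. i < m \<Longrightarrow> S i \<in> carrier_mat n (q i)"
    and "\<And>i. i < m \<Longrightarrow> L i \<in> carrier_mat (q i) n"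
    and "\<And>i k. i < k \<Longrightarrow> k < m \<Longrightarrow> L k * S i = 0\<^sub>m (q k) (q i)"
    and "\<And>k v. k < m \<Longrightarrow> v \<in> carrier_vec (q k) \<Longrightarrow> L k * S k *\<^sub>v v = 0\<^sub>v (q k) \<Longrightarrow> v = 0\<^sub>v (q k)"
  shows "\<exists>T \<in> carrier_mat n (\<Sum>i<m. q i).
      (\<forall>v \<in> carrier_vec (\<Sum>i<m. q i). T *\<^sub>v v = 0\<^sub>v n \<longrightarrow> v = 0\<^sub>v (\<Sum>i<m. q i)) \<and>
      (\<forall>r. \<forall>M \<in> carrier_mat r n. (\<forall>i<m. M * S i = 0\<^sub>m r (q i)) \<longrightarrow> M * T = 0\<^sub>m r (\<Sum>i<m. q i))"
  using assms
proof (induction m)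
  case 0
  show ?case by (rule bexI[of _ "0\<^sub>m n 0"]) auto
next
  case (Suc m)
  define s where "s = (\<Sum>i<m. q i)"
  have s': "(\<Sum>i<Suc m. q i) = s + q m" by (simp add: s_def)
  have "\<exists>T \<in> carrier_mat n s.
      (\<forall>v \<in> carrier_vec s. T *\<^sub>v v = 0\<^sub>v n \<longrightarrow> v = 0\<^sub>v s) \<and>
      (\<forall>r. \<forall>M \<in> carrier_mat r n. (\<forall>i<m. M * S i = 0\<^sub>m r (q i)) \<longrightarrow> M * T = 0\<^sub>m r s)"
    unfolding s_def
  proof (rule Suc.IH)
    show "v = 0\<^sub>v (q k)"
      if "k < m" "v \<in> carrier_vec (q k)" "L k * S k *\<^sub>v v = 0\<^sub>v (q k)" for k v
      using Suc.prems(4)[OF _ that(2,3)] that(1) by simp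
  qed (use Suc.prems(1-3) in auto)
  then obtain T where T: "T \<in> carrier_mat n s"
    and Tinj: "\<And>v. v \<in> carrier_vec s \<Longrightarrow> T *\<^sub>v v = 0\<^sub>v n \<Longrightarrow> v = 0\<^sub>v s"
    and Tkill: "\<And>r M. M \<in> carrier_mat r n \<Longrightarrow> (\<And>i. i < m \<Longrightarrow> M * S i = 0\<^sub>m r (q i)) \<Longrightarrow> M * T = 0\<^sub>m r s"
    by blast
  have Sm: "S m \<in> carrier_mat n (q m)" and Lm: "L m \<in> carrier_mat (q m) n"
    using Suc.prems by auto
  have LT: "L m * T = 0\<^sub>m (q m) s" using Suc.prems(3) by (intro Tkill[OF Lm]) auto
  \<comment> \<open>Two lower blocks without rows make this \<open>[T, S m]\<close>.\<close>
  define T' where "T' = four_block_mat T (S m) (0\<^sub>m 0 s) (0\<^sub>m 0 (q m))"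
  have T': "T' \<in> carrier_mat n (s + q m)"
    unfolding T'_def using four_block_carrier_mat[OF T, of "0\<^sub>m 0 (q m)" 0 "q m"] by simp
  have "v = 0\<^sub>v (s + q m)" if v: "v \<in> carrier_vec (s + q m)" and 0: "T' *\<^sub>v v = 0\<^sub>v n" for v
  proof -
    define a b where "a = vec_first v s" and "b = vec_last v (q m)"
    have vab: "v = a @\<^sub>v b" and a: "a \<in> carrier_vec s" and b: "b \<in> carrier_vec (q m)"
      using v by (auto simp: a_def b_def)
    have "T' *\<^sub>v v = (T *\<^sub>v a + S m *\<^sub>v b) @\<^sub>v (0\<^sub>m 0 s *\<^sub>v a + 0\<^sub>m 0 (q m) *\<^sub>v b)"
      unfolding T'_def vab by (rule four_block_mat_mult_vec[OF T Sm _ _ a b]) auto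
    also have "\<dots> = T *\<^sub>v a + S m *\<^sub>v b" using T Sm by (intro eq_vecI) auto
    finally have sum0: "T *\<^sub>v a + S m *\<^sub>v b = 0\<^sub>v n" using 0 by simp
    have "L m * S m *\<^sub>v b = L m * T *\<^sub>v a + L m * S m *\<^sub>v b"
      unfolding LT using a b Lm Sm by (intro eq_vecI) auto
    also have "\<dots> = L m *\<^sub>v (T *\<^sub>v a + S m *\<^sub>v b)"
      using Lm T Sm a b by (simp add: mult_add_distrib_mat_vec[of _ "q m" n])
    also have "\<dots> = 0\<^sub>v (q m)" unfolding sum0 using Lm by (intro eq_vecI) auto
    finally have b0: "b = 0\<^sub>v (q m)" using Suc.prems(4) b by blast
    have "S m *\<^sub>v 0\<^sub>v (q m) = 0\<^sub>v n" using Sm by (intro eq_vecI) auto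
    then have "T *\<^sub>v a = 0\<^sub>v n" using sum0 T a unfolding b0 by simp
    then have "a = 0\<^sub>v s" using Tinj a by blast
    then show ?thesis unfolding vab b0 by (intro eq_vecI) auto
  qed
  moreover have "M * T' = 0\<^sub>m r (s + q m)"
    if M: "M \<in> carrier_mat r n" and kill: "\<forall>i<Suc m. M * S i = 0\<^sub>m r (q i)" for r M
  proof -
    have MT: "M * T = 0\<^sub>m r s" using kill by (intro Tkill[OF M]) auto
    have MS: "M * S m = 0\<^sub>m r (q m)" using kill by auto
    have "M = four_block_mat M (0\<^sub>m r 0) (0\<^sub>m 0 n) (0\<^sub>m 0 0)"
      using M by (intro eq_matI) auto
    then have "M * T' = four_block_mat M (0\<^sub>m r 0) (0\<^sub>m 0 n) (0\<^sub>m 0 0) * T'" by simp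
    also have "\<dots> = four_block_mat (0\<^sub>m r s) (0\<^sub>m r (q m)) (0\<^sub>m 0 s) (0\<^sub>m 0 (q m))"
      unfolding T'_def
      by (subst mult_four_block_mat[OF M _ _ _ T Sm]) (use T Sm MT MS in auto)
    finally show ?thesis by simp
  qed
  ultimately show ?case unfolding s' using T' by blast
qed

text \<open>The concatenation of the blocks is now square, so independence of its columns makes it
  invertible, and it can be cancelled from \<open>M * T = 0\<close>.\<close>

lemma zero_on_block_triangular_family:
  fixes S L :: "nat \<Rightarrow> 'a::field mat"
  assumes "\<And>i. i < m \<Longrightarrow> S i \<in> carrier_mat n (q i)"
    and "\<And>i. i < m \<Longrightarrow> L i \<in> carrier_mat (q i) n"
    and "\<And>i k. i < k \<Longrightarrow> k < m \<Longrightarrow> L k * S i = 0\<^sub>m (q k) (q i)"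
    and "\<And>k v. k < m \<Longrightarrow> v \<in> carrier_vec (q k) \<Longrightarrow> L k * S k *\<^sub>v v = 0\<^sub>v (q k) \<Longrightarrow> v = 0\<^sub>v (q k)"
    and total: "(\<Sum>i<m. q i) = n"
    and M: "M \<in> carrier_mat r n" and kill: "\<And>i. i < m \<Longrightarrow> M * S i = 0\<^sub>m r (q i)"
  shows "M = 0\<^sub>m r n"
proof -
  have "\<exists>T \<in> carrier_mat n n. (\<forall>v \<in> carrier_vec n. T *\<^sub>v v = 0\<^sub>v n \<longrightarrow> v = 0\<^sub>v n) \<and>
      (\<forall>r. \<forall>M \<in> carrier_mat r n. (\<forall>i<m. M * S i = 0\<^sub>m r (q i)) \<longrightarrow> M * T = 0\<^sub>m r n)"
    using block_triangular_concatenation[where S = S and L = L and m = m and q = q and n = n,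
        unfolded total, OF assms(1-4)] .
  then obtain T where T: "T \<in> carrier_mat n n"
    and Tinj: "\<And>v. v \<in> carrier_vec n \<Longrightarrow> T *\<^sub>v v = 0\<^sub>v n \<Longrightarrow> v = 0\<^sub>v n"
    and "\<And>r M. M \<in> carrier_mat r n \<Longrightarrow> (\<forall>i<m. M * S i = 0\<^sub>m r (q i)) \<Longrightarrow> M * T = 0\<^sub>m r n"
    by blast
  then have MT: "M * T = 0\<^sub>m r n" using M kill by blast
  obtain B where B: "B \<in> carrier_mat n n" "T * B = 1\<^sub>m n"
    using trivial_kernel_imp_mat_inverse[OF T Tinj] by metis
  have "M = M * (T * B)" using B M by simp
  also have "\<dots> = M * T * B" using assoc_mult_mat[OF M T B(1)] by simp
  also have "\<dots> = 0\<^sub>m r n" using MT B(1) by simp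
  finally show ?thesis .
qed

section \<open>The hereditary property\<close>

lemma minus_eq_zero_mat_iff:
  fixes A B :: "'a::group_add mat"
  assumes "A \<in> carrier_mat nr nc" "B \<in> carrier_mat nr nc"
  shows "A - B = 0\<^sub>m nr nc \<longleftrightarrow> A = B"
  using assms by (auto simp: mat_eq_iff)

lemma error_update_mult:
  fixes Q A E B X :: "'a::ring mat"
  assumes "Q \<in> carrier_mat n n" "A \<in> carrier_mat n n" "E \<in> carrier_mat n n" "B \<in> carrier_mat n n"
    "X \<in> carrier_mat n p"
  shows "(Q + A * E * B) * X = Q * X + A * (E * (B * X))"
  using assms
  by (simp add: add_mult_distrib_mat[of _ n n] assoc_mult_mat[of _ n n _ n _ p])

theorem proposition2p1:
  fixes n \<rho> :: nat and q :: "nat \<Rightarrow> nat"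
    and S W :: "nat \<Rightarrow> real mat" and Q G0 :: "real mat"
  assumes "n \<ge> 1"
    and "\<And>i. i \<le> \<rho> \<Longrightarrow> q i \<ge> 1"
    and "(\<Sum>i\<le>\<rho>. q i) = n"
    and "\<And>i. i \<le> \<rho> \<Longrightarrow> S i \<in> carrier_mat n (q i)"
    and "\<And>i. i \<le> \<rho> \<Longrightarrow> vec_space.rank n (S i) = q i"
    and "Q \<in> carrier_mat n n" and "sym_mat Q"
    and "G0 \<in> carrier_mat n n" and "sym_mat G0"
    and "\<And>i. i \<le> \<rho> \<Longrightarrow> W i \<in> carrier_mat n n"
    and "\<And>i. i \<le> \<rho> \<Longrightarrow> sym_pos_def_mat (W i)"
    and "\<And>i k. i < k \<Longrightarrow> k \<le> \<rho> \<Longrightarrow> (S k)\<^sup>T * W k * S i = 0\<^sub>m (q k) (q i)"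
  shows "(\<forall>i k. i \<le> k \<and> k \<le> \<rho> \<longrightarrow> G_seq n Q G0 S W (Suc k) * S i = Q * S i)
    \<and> G_seq n Q G0 S W (Suc \<rho>) = Q"
proof -
  let ?G = "G_seq n Q G0 S W"
  let ?A = "\<lambda>k. 1\<^sub>m n - W k * proj_mat (S k) (W k)"
  let ?B = "\<lambda>k. 1\<^sub>m n - proj_mat (S k) (W k) * W k"
  note S = assms(4) and Q = assms(6) and W = assms(10) and pd = assms(11) and conj = assms(12)
  have inj: "v = 0\<^sub>v (q i)" if "i \<le> \<rho>" "v \<in> carrier_vec (q i)" "S i *\<^sub>v v = 0\<^sub>v n" for i v
    using full_column_rank_imp_trivial_kernel[OF S assms(5)] that by blast
  have P: "proj_mat (S k) (W k) \<in> carrier_mat n n" if "k \<le> \<rho>" for k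
    using proj_mat_carrier[OF S W pd inj] that by blast
  have BS: "?B k * S k = 0\<^sub>m n (q k)" if "k \<le> \<rho>" for k
    using proj_mat_complement_annihilates[OF S W pd inj] that by blast
  have BX: "?B k * S i = S i" if "i < k" "k \<le> \<rho>" for i k
  proof (rule proj_mat_complement_fixes)
    show "S k \<in> carrier_mat n (q k)" "W k \<in> carrier_mat n n" "sym_pos_def_mat (W k)"
      using S W pd that by auto
    show "S i \<in> carrier_mat n (q i)" using S that by simp
    show "(S k)\<^sup>T * W k * S i = 0\<^sub>m (q k) (q i)" using conj that by blast
    show "v = 0\<^sub>v (q k)" if "v \<in> carrier_vec (q k)" "S k *\<^sub>v v = 0\<^sub>v n" for v
      using inj \<open>k \<le> \<rho>\<close> that by blast
  qed
  have A: "?A k \<in> carrier_mat n n" and B: "?B k \<in> carrier_mat n n" if "k \<le> \<rho>" for k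
    using W P that by (auto intro!: minus_carrier_mat mult_carrier_mat)
  have G: "?G k \<in> carrier_mat n n" if "k \<le> Suc \<rho>" for k
    using that
  proof (induction k)
    case 0 then show ?case using assms(8) by simp
  next
    case (Suc k)
    have "?A k * (?G k - Q) * ?B k \<in> carrier_mat n n"
      using A[of k] B[of k] Q Suc by (intro mult_carrier_mat[of _ n n]) auto
    then show ?case by simp
  qed
  have update: "?G (Suc k) * S i = Q * S i + ?A k * ((?G k - Q) * (?B k * S i))"
    if "i \<le> \<rho>" "k \<le> \<rho>" for i k
    unfolding G_seq.simps
    by (rule error_update_mult[OF Q A minus_carrier_mat[OF Q] B S]) (fact that)+
  \<comment> \<open>Both ways of creating or keeping an equation \<open>E\<^sub>k\<^sub>+\<^sub>1 S\<^sub>i = 0\<close> pass through this criterion: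
    \<open>B\<^sub>k S\<^sub>i = 0\<close> when \<open>i = k\<close>, and \<open>E\<^sub>k S\<^sub>i = 0\<close> with \<open>B\<^sub>k S\<^sub>i = S\<^sub>i\<close> when \<open>i < k\<close>.\<close>
  have vanish: "?G (Suc k) * S i = Q * S i"
    if "i \<le> \<rho>" "k \<le> \<rho>" "(?G k - Q) * (?B k * S i) = 0\<^sub>m n (q i)" for i k
    unfolding update[OF that(1,2)] that(3) right_mult_zero_mat[OF A[OF that(2)]]
    using mult_carrier_mat[OF Q S[OF that(1)]] by (rule right_add_zero_mat)
  have hereditary: "?G (Suc k) * S i = Q * S i" if "i \<le> k" "k \<le> \<rho>" for i k
    using that
  proof (induction k rule: dec_induct)
    case base
    show ?case
      by (rule vanish[OF base base])
        (simp only: BS[OF base] right_mult_zero_mat[OF minus_carrier_mat[OF Q]])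
  next
    case (step k)
    have i: "i \<le> \<rho>" using step.hyps step.prems by simp
    have GS: "?G (Suc k) * S i = Q * S i" using step.IH step.prems by linarith
    have "(?G (Suc k) - Q) * (?B (Suc k) * S i) = (?G (Suc k) - Q) * S i"
      using BX[of i "Suc k"] step.hyps step.prems by simp
    also have "\<dots> = ?G (Suc k) * S i - Q * S i"
      using step.prems by (intro minus_mult_distrib_mat[OF G Q S[OF i]]) simp
    also have "\<dots> = 0\<^sub>m n (q i)"
      unfolding GS using mult_carrier_mat[OF Q S[OF i]] by (rule minus_r_inv_mat)
    finally show ?case by (rule vanish[OF i step.prems])
  qed
  \<comment> \<open>\<open>L k = S\<^sub>k\<^sup>T W\<^sub>k\<close> makes the conjugacy hypothesis the triangularity condition and the Gram
    matrices the diagonal blocks.\<close>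
  have "?G (Suc \<rho>) - Q = 0\<^sub>m n n"
  proof (rule zero_on_block_triangular_family)
    show "S i \<in> carrier_mat n (q i)" if "i < Suc \<rho>" for i using S that by simp
    show "(S i)\<^sup>T * W i \<in> carrier_mat (q i) n" if "i < Suc \<rho>" for i
      using S[of i] W[of i] that by auto
    show "(S k)\<^sup>T * W k * S i = 0\<^sub>m (q k) (q i)" if "i < k" "k < Suc \<rho>" for i k
      using conj that by simp
    show "v = 0\<^sub>v (q k)"
      if "k < Suc \<rho>" "v \<in> carrier_vec (q k)" "(S k)\<^sup>T * W k * S k *\<^sub>v v = 0\<^sub>v (q k)" for k v
    proof (rule weighted_gram_trivial_kernel)
      have k: "k \<le> \<rho>" using that(1) by simp
      show "S k \<in> carrier_mat n (q k)" "W k \<in> carrier_mat n n" "sym_pos_def_mat (W k)"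
        using S W pd k by blast+
      show "w = 0\<^sub>v (q k)" if "w \<in> carrier_vec (q k)" "S k *\<^sub>v w = 0\<^sub>v n" for w
        using inj k that by blast
    qed (fact that)+
    show "(\<Sum>i<Suc \<rho>. q i) = n" using assms(3) by (simp add: lessThan_Suc_atMost)
    show "?G (Suc \<rho>) - Q \<in> carrier_mat n n" by (rule minus_carrier_mat[OF Q])
    show "(?G (Suc \<rho>) - Q) * S i = 0\<^sub>m n (q i)" if "i < Suc \<rho>" for i
    proof -
      have i: "i \<le> \<rho>" using that by simp
      show ?thesis
        unfolding minus_mult_distrib_mat[OF G[OF order_refl] Q S[OF i]] hereditary[OF i order_refl]
        using mult_carrier_mat[OF Q S[OF i]] by (rule minus_r_inv_mat)
    qed
  qed
  then have "?G (Suc \<rho>) = Q" unfolding minus_eq_zero_mat_iff[OF G[OF order_refl] Q] .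
  then show ?thesis using hereditary by blast
qed

end
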